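(* For a positive integer $n$, let $N(n)$ be the maximum number of permutations of $[n]=\{1,\dots,n\}$ that are pairwise locally encapsulating. Then for every real $\alpha<1$ there exists $n_0$ such that for all $n\ge n_0$, $$\lfloor \alpha n\rfloor ! < N(n)\le n!.$$
   Context: A permutation of $[n]$ is a bijection $[n]\to[n]$; for a permutation $\sigma$ and $a\in[n]$, $\sigma^{-1}(a)$ is the position of $a$ when $\sigma$ is viewed as the linear order $\sigma(1),\dots,\sigma(n)$. Two permutations $\sigma,\tau$ of $[n]$ are called locally encapsulating if there exist elements $a,b\in[n]$ with $\sigma^{-1}(a)<\sigma^{-1}(b)$ and $\tau^{-1}(a)<\tau^{-1}(b)$ such that one of the intervals $[\sigma^{-1}(a),\sigma^{-1}(b)]$ and $[\tau^{-1}(a),\tau^{-1}(b)]$ strictly contains the other. *)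

theory Defs
  imports Complex_Main "HOL-Combinatorics.Permutations"
begin

(* A permutation of [n] is a function with p permutes {1..n}; since such a p is a
   bijection of the whole type nat, inv p a is the position of a in p 1, ..., p n. *)

definition locally_encapsulating :: "nat \<Rightarrow> (nat \<Rightarrow> nat) \<Rightarrow> (nat \<Rightarrow> nat) \<Rightarrow> bool" where
  "locally_encapsulating n \<sigma> \<tau> \<longleftrightarrow>
    (\<exists>a\<in>{1..n}. \<exists>b\<in>{1..n}.
       inv \<sigma> a < inv \<sigma> b \<and> inv \<tau> a < inv \<tau> b \<and>
       ({inv \<sigma> a..inv \<sigma> b} \<subset> {inv \<tau> a..inv \<tau> b} \<or>
        {inv \<tau> a..inv \<tau> b} \<subset> {inv \<sigma> a..inv \<sigma> b}))"

(* Members of a family are distinct permutations; pairwise ranges over pairs of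
   different members. *)

definition encapsulating_families :: "nat \<Rightarrow> (nat \<Rightarrow> nat) set set" where
  "encapsulating_families n =
    {F. F \<subseteq> {p. p permutes {1..n}} \<and> pairwise (locally_encapsulating n) F}"

definition max_encapsulating :: "nat \<Rightarrow> nat" where
  "max_encapsulating n = Max (card ` encapsulating_families n)"

(* The maximum is taken over a finite nonempty set, so Max is meaningful. *)

lemma finite_encapsulating_families: "finite (encapsulating_families n)"
proof (rule finite_subset)
  show "encapsulating_families n \<subseteq> Pow {p. p permutes {1..n}}"
    by (auto simp: encapsulating_families_def)
  show "finite (Pow {p. p permutes {1..n}})"
    by (simp add: finite_permutations)
qed

lemma encapsulating_families_nonempty: "encapsulating_families n \<noteq> {}"
proof -
  have "{} \<in> encapsulating_families n"
    by (simp add: encapsulating_families_def pairwise_def)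
  then show ?thesis by blast
qed

end

theory Submission
  imports Defs
begin

text \<open>
  The permutations with \<open>1\<close> in first position already form an encapsulating family: if two of
  them place some \<open>b\<close> differently, the intervals spanned by \<open>1\<close> and \<open>b\<close> share their left end but
  not their right end. Hence \<open>N(n) \<ge> (n-1)!\<close>, and \<open>\<lfloor>\<alpha> n\<rfloor> < n - 1\<close> for large \<open>n\<close>.
\<close>

lemma locally_encapsulating_fix_1:
  assumes \<sigma>: "\<sigma> permutes {2..n}" and \<tau>: "\<tau> permutes {2..n}" and "\<sigma> \<noteq> \<tau>"
  shows "locally_encapsulating n \<sigma> \<tau>"
proof -
  have perm: "inv \<sigma> permutes {2..n}" "inv \<tau> permutes {2..n}"
    using \<sigma> \<tau> by (auto intro: permutes_inv)
  have "inv \<sigma> \<noteq> inv \<tau>"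
    using \<open>\<sigma> \<noteq> \<tau>\<close> permutes_inv_inv[OF \<sigma>] permutes_inv_inv[OF \<tau>] by metis
  then obtain b where b: "inv \<sigma> b \<noteq> inv \<tau> b" by blast
  \<comment> \<open>Outside \<open>{2..n}\<close> both inverses are the identity, so they cannot
    differ there.\<close>
  have b_mem: "b \<in> {2..n}"
    using b perm by (metis permutes_not_in)
  then have "inv \<sigma> b \<in> {2..n}" "inv \<tau> b \<in> {2..n}"
    using perm by (simp_all only: permutes_in_image)
  moreover have "inv \<sigma> 1 = 1" "inv \<tau> 1 = 1"
    using perm by (auto intro: permutes_not_in)
  \<comment> \<open>Both intervals start at position 1, so the one with the smaller right end is
    strictly inside the other; \<open>b\<close> lies in \<open>{2..n}\<close>, hence comes after 1
    in both orders.\<close>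
  ultimately show ?thesis
    unfolding locally_encapsulating_def
    using b b_mem by (intro bexI[of _ 1] bexI[of _ b]) auto
qed

lemma fact_le_max_encapsulating: "fact (n - 1) \<le> max_encapsulating n"
proof -
  let ?F = "{p. p permutes {2..n}}"
  have "?F \<in> encapsulating_families n"
    unfolding encapsulating_families_def pairwise_def
    by (auto intro: locally_encapsulating_fix_1 permutes_subset)
  then have "card ?F \<le> max_encapsulating n"
    unfolding max_encapsulating_def by (simp add: finite_encapsulating_families)
  \<comment> \<open>Truncated subtraction is harmless: for n = 0 the set \<open>{2..n}\<close> is
    empty and \<open>?F\<close> consists of the identity.\<close>
  moreover have "card ?F = fact (n - 1)"
    by (rule card_permutations) auto
  ultimately show ?thesis by simp
qed

lemma max_encapsulating_le_fact: "max_encapsulating n \<le> fact n"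
proof -
  have "card F \<le> fact n" if "F \<in> encapsulating_families n" for F
  proof -
    have "card F \<le> card {p. p permutes {1..n}}"
      using that by (intro card_mono) (auto simp: encapsulating_families_def finite_permutations)
    also have "\<dots> = fact n" by (rule card_permutations) auto
    finally show ?thesis .
  qed
  then show ?thesis
    unfolding max_encapsulating_def
    by (simp add: finite_encapsulating_families encapsulating_families_nonempty)
qed

theorem theorem2:
  fixes \<alpha> :: real
  assumes "\<alpha> < 1"
  shows "\<exists>n\<^sub>0::nat. \<forall>n\<ge>n\<^sub>0.
    fact (nat \<lfloor>\<alpha> * real n\<rfloor>) < max_encapsulating n \<and> max_encapsulating n \<le> fact n"
proof -
  \<comment> \<open>For n \<ge> m this gives (1 - \<alpha>) n > 1, that is, \<alpha> n < n -
    1.\<close>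
  obtain m :: nat where m: "1 / (1 - \<alpha>) < real m"
    using reals_Archimedean2 by blast
  \<comment> \<open>The bound 3 ensures n - 2 \<ge> 1, avoiding the equality 0! = 1! in the strict
    step below.\<close>
  have "fact (nat \<lfloor>\<alpha> * real n\<rfloor>) < max_encapsulating n" if n: "n \<ge> max m 3" for n
  proof -
    have "1 / (1 - \<alpha>) < real n" using m n by simp
    then have "\<alpha> * real n < real n - 1"
      using assms by (simp add: field_simps)
    \<comment> \<open>The floor is an integer below n - 1; for negative \<alpha>, \<open>nat\<close>
      sends it to 0.\<close>
    then have "nat \<lfloor>\<alpha> * real n\<rfloor> \<le> n - 2"
      using n by linarith
    then have "fact (nat \<lfloor>\<alpha> * real n\<rfloor>) \<le> (fact (n - 2) :: nat)"
      by (rule fact_mono)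
    also have "\<dots> < fact (n - 1)"
      using n by (intro fact_less_mono) auto
    also have "\<dots> \<le> max_encapsulating n"
      by (rule fact_le_max_encapsulating)
    finally show ?thesis .
  qed
  then show ?thesis
    using max_encapsulating_le_fact by blast
qed

end
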